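(* Let $M$ and $N$ be two quasianalytic weight sequences such that $\sup_{k\in\mathbb N_{>0}}n_k^{1/k}=+\infty$ (Roumieu case) resp. $\lim_{k\to+\infty}n_k^{1/k}=+\infty$ (Beurling case), i.e. $\mathcal O^{0,r}\subsetneq\mathcal E^{0,r}_{\{N\}}$ resp. $\mathcal O^{0,r}\subsetneq\mathcal E^{0,r}_{(N)}$. Then $j^\infty(\mathcal E^{0,r}_{\{M\}})\cap\Lambda^r_{[N]}\subsetneq\Lambda^r_{[N]}$ (and hence also $j^\infty(\mathcal E^{0,r}_{(M)})\cap\Lambda^r_{[N]}\subsetneq\Lambda^r_{[N]}$). In particular the Borel map $j^\infty:\mathcal E^{0,r}_{[N]}\to\Lambda^r_{[N]}$ is not surjective.
   Context: For a sequence $M=(M_p)_{p\in\mathbb N}$ of positive reals write $m_p:=M_p/p!$ (and $n_p:=N_p/p!$). $M$ is a weight sequence if $1=M_0\le M_1$, $M_p^2\le M_{p-1}M_{p+1}$ for all $p\ge1$, and $\liminf_{p\to\infty}m_p^{1/p}>0$; it is quasianalytic if $\sum_{p\ge1}M_{p-1}/M_p=+\infty$. For $U\subseteq\mathbb R^r$ open, $K\subseteq U$ compact, $h>0$: $\|f\|^M_{K,h}:=\sup_{\alpha\in\mathbb N^r,x\in K}|\partial^\alpha f(x)|/(h^{|\alpha|}M_{|\alpha|})$. $\mathcal E_{\{M\}}(U)$ (Roumieu) consists of smooth $f$ such that for every compact $K\subseteq U$ there exists $h>0$ with $\|f\|^M_{K,h}<\infty$; $\mathcal E_{(M)}(U)$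 (Beurling): for every compact $K$ and every $h>0$. $\mathcal E^{0,r}_{\{M\}}$, $\mathcal E^{0,r}_{(M)}$ are the spaces of germs at $0\in\mathbb R^r$ of functions in the respective class on some cube $(-1/k,1/k)^r$; $\mathcal O^{0,r}$ is the space of germs at $0$ of real analytic functions. For $\mathbf b=(b_\alpha)_{\alpha\in\mathbb N^r}$ and $h>0$: $|\mathbf b|^N_h:=\sup_\alpha|b_\alpha|/(h^{|\alpha|}n_{|\alpha|})$; $\Lambda^r_{\{N\}}:=\{\mathbf b:\exists h>0,|\mathbf b|^N_h<\infty\}$, $\Lambda^r_{(N)}:=\{\mathbf b:\forall h>0,|\mathbf b|^N_h<\infty\}$. The Borel map is $j^\infty(f)=(\partial^\alpha f(0)/|\alpha|!)_{\alpha\in\mathbb N^r}$. The notation $[\cdot]$ means either $\{\cdot\}$ throughout (Roumieu) or $(\cdot)$ throughout (Beurling). *)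

theory Defs
  imports "HOL-Analysis.Analysis" "HOL-Library.Multiset"
begin

definition weight_seq :: "(nat \<Rightarrow> real) \<Rightarrow> bool" where
  "weight_seq M \<longleftrightarrow>
     (\<forall>p. M p > 0) \<and> M 0 = 1 \<and> M 0 \<le> M 1 \<and>
     (\<forall>p\<ge>1. (M p)\<^sup>2 \<le> M (p - 1) * M (p + 1)) \<and>
     liminf (\<lambda>p. ereal (root p (M p / fact p))) > 0"

definition quasianalytic :: "(nat \<Rightarrow> real) \<Rightarrow> bool" where
  "quasianalytic M \<longleftrightarrow> \<not> summable (\<lambda>p. M p / M (Suc p))"
  (* sum_{p>=1} M_{p-1}/M_p = +infinity; the terms are positive *)

definition pdiff :: "'n::finite \<Rightarrow> (real^'n \<Rightarrow> real) \<Rightarrow> real^'n \<Rightarrow> real" where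
  "pdiff i f = (\<lambda>x. deriv (\<lambda>t. f (x + t *\<^sub>R axis i 1)) 0)"

fun diffs :: "'n::finite list \<Rightarrow> (real^'n \<Rightarrow> real) \<Rightarrow> real^'n \<Rightarrow> real" where
  "diffs [] f = f"
| "diffs (i # is) f = pdiff i (diffs is f)"

definition smooth_on :: "(real^'n::finite) set \<Rightarrow> (real^'n \<Rightarrow> real) \<Rightarrow> bool" where
  "smooth_on U f \<longleftrightarrow>
     (\<forall>is. continuous_on U (diffs is f) \<and>
        (\<forall>i. \<forall>x\<in>U. (\<lambda>t. diffs is f (x + t *\<^sub>R axis i 1)) differentiable (at 0)))"

text \<open>Multi-indices alpha in N^r are multisets over the coordinate type; |alpha| = size alpha.
  For smooth functions the order of differentiation is irrelevant.\<close>
definition Dalpha :: "'n::finite multiset \<Rightarrow> (real^'n \<Rightarrow> real) \<Rightarrow> real^'n \<Rightarrow> real" where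
  "Dalpha \<alpha> f = diffs (SOME xs. mset xs = \<alpha>) f"

definition bounded_MKh :: "(nat \<Rightarrow> real) \<Rightarrow> (real^'n::finite) set \<Rightarrow> real \<Rightarrow> (real^'n \<Rightarrow> real) \<Rightarrow> bool" where
  "bounded_MKh M K h f \<longleftrightarrow>
     (\<exists>C. \<forall>\<alpha> x. x \<in> K \<longrightarrow> \<bar>Dalpha \<alpha> f x\<bar> / (h ^ size \<alpha> * M (size \<alpha>)) \<le> C)"

definition E_Roumieu :: "(nat \<Rightarrow> real) \<Rightarrow> (real^'n::finite) set \<Rightarrow> (real^'n \<Rightarrow> real) set" where
  "E_Roumieu M U = {f. smooth_on U f \<and>
      (\<forall>K. compact K \<and> K \<subseteq> U \<longrightarrow> (\<exists>h>0. bounded_MKh M K h f))}"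

definition E_Beurling :: "(nat \<Rightarrow> real) \<Rightarrow> (real^'n::finite) set \<Rightarrow> (real^'n \<Rightarrow> real) set" where
  "E_Beurling M U = {f. smooth_on U f \<and>
      (\<forall>K. compact K \<and> K \<subseteq> U \<longrightarrow> (\<forall>h>0. bounded_MKh M K h f))}"

definition cube :: "nat \<Rightarrow> (real^'n::finite) set" where
  "cube k = {x. \<forall>i. \<bar>x $ i\<bar> < 1 / real k}"

definition jet :: "(real^'n::finite \<Rightarrow> real) \<Rightarrow> 'n multiset \<Rightarrow> real" where
  "jet f = (\<lambda>\<alpha>. Dalpha \<alpha> f 0 / fact (size \<alpha>))"

definition jet_germs_Roumieu :: "(nat \<Rightarrow> real) \<Rightarrow> ('n::finite multiset \<Rightarrow> real) set" where
  "jet_germs_Roumieu M = {jet f | f k. k \<ge> 1 \<and> f \<in> E_Roumieu M (cube k)}"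

definition jet_germs_Beurling :: "(nat \<Rightarrow> real) \<Rightarrow> ('n::finite multiset \<Rightarrow> real) set" where
  "jet_germs_Beurling M = {jet f | f k. k \<ge> 1 \<and> f \<in> E_Beurling M (cube k)}"

definition seq_bounded :: "(nat \<Rightarrow> real) \<Rightarrow> real \<Rightarrow> ('n::finite multiset \<Rightarrow> real) \<Rightarrow> bool" where
  "seq_bounded N h b \<longleftrightarrow>
     (\<exists>C. \<forall>\<alpha>. \<bar>b \<alpha>\<bar> / (h ^ size \<alpha> * (N (size \<alpha>) / fact (size \<alpha>))) \<le> C)"

definition Lambda_Roumieu :: "(nat \<Rightarrow> real) \<Rightarrow> ('n::finite multiset \<Rightarrow> real) set" where
  "Lambda_Roumieu N = {b. \<exists>h>0. seq_bounded N h b}"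

definition Lambda_Beurling :: "(nat \<Rightarrow> real) \<Rightarrow> ('n::finite multiset \<Rightarrow> real) set" where
  "Lambda_Beurling N = {b. \<forall>h>0. seq_bounded N h b}"

end

theory Submission
  imports Defs
begin

text \<open>
  Restricting to a coordinate axis reduces the theorem to one variable. There, Bang's argument shows
  that a function of a quasianalytic class all of whose derivatives at 0 are positive is absolutely
  monotone to the right of 0: a negative value of some derivative would give, by Rolle-type
  arguments, zeros \<open>z\<^sub>k\<close> of all the higher derivatives which decrease with \<open>k\<close>, hence have
  finite total variation, and in a quasianalytic class this forces the function to vanish to the
  right of \<open>z\<^sub>0\<close>. By Taylor's formula the Taylor series at 0 then converges. Hence
  no positive sequence \<open>c\<^sub>k\<close> with unbounded \<open>c\<^sub>k\<^bsup>1/k\<^esup>\<close> is a jet; take \<open>c\<^sub>k = n\<^sub>k\<close> in the Roumieu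
  case and \<open>c\<^sub>k = n\<^sub>k\<^bsup>1/2\<^esup>\<close> in the Beurling case.
\<close>

section \<open>Bang's vanishing theorem in one variable\<close>

text \<open>
  At the point \<open>x\<close> only the derivatives of order \<open>k\<close> with \<open>z k \<le> x\<close> are controlled; moving to the
  right past \<open>z k\<close>, the derivative of order \<open>k\<close> joins them, starting from the value 0.
  Orders above \<open>n\<close> satisfy the bound trivially because \<open>c\<close> is at least \<open>exp (- Suc n)\<close>.
\<close>

lemma bang_propagate:
  fixes M :: "nat \<Rightarrow> real" and F :: "nat \<Rightarrow> real \<Rightarrow> real"
  assumes pos: "\<And>k. M k > 0"
    and ratio: "\<And>j k. j \<le> k \<Longrightarrow> M (Suc j) / M j \<le> M (Suc k) / M k"
    and deriv: "\<And>k t. t \<in> {a..b} \<Longrightarrow> (F k has_real_derivative F (Suc k) t) (at t)"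
    and bound: "\<And>k t. t \<in> {a..b} \<Longrightarrow> \<bar>F k t\<bar> \<le> M k"
    and zero: "\<And>k. F k (z k) = 0" and z: "\<And>k. z k \<in> {a..b}" and dec: "decseq z"
    and start: "\<And>k. z k \<le> x \<Longrightarrow> \<bar>F k x\<bar> \<le> c * exp (real k) * M k"
    and x: "a \<le> x" and c: "exp (- real (Suc n)) \<le> c"
    and y: "x \<le> y" "y \<le> b" "z k \<le> y"
  shows "\<bar>F k y\<bar> \<le> c * exp (exp 1 * (M (Suc n) / M n) * (y - x)) * exp (real k) * M k"
  using y
\<comment> \<open>The truncated difference is 0 exactly for the orders \<open>k > n\<close>, the
  base case; the induction then descends from \<open>Suc k\<close> to \<open>k\<close>, with
  \<open>y\<close> arbitrary because \<open>F (Suc k)\<close> must be bounded on a whole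
  interval.\<close>
proof (induction "Suc n - k" arbitrary: k y)
  case 0
  have "0 < c" using c by (meson exp_gt_zero less_le_trans)
  have "1 \<le> exp (- real (Suc n)) * exp (real k)"
    using 0 by (simp flip: exp_add)
  also have "\<dots> \<le> c * exp (real k)" using c by simp
  also have "\<dots> \<le> c * exp (real k) * exp (exp 1 * (M (Suc n) / M n) * (y - x))"
    using \<open>0 < c\<close> pos[of n] pos[of "Suc n"] 0 by simp
  finally have "1 * M k \<le> c * exp (real k) * exp (exp 1 * (M (Suc n) / M n) * (y - x)) * M k"
    using pos[of k] by (intro mult_right_mono) auto
  moreover have "\<bar>F k y\<bar> \<le> M k" using 0 x by (intro bound) auto
  ultimately show ?case by (simp add: mult_ac)
next
  case (Suc d)
  have "0 < c" using c by (meson exp_gt_zero less_le_trans)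
  define L where "L = exp 1 * (M (Suc n) / M n)"
  have "L > 0" unfolding L_def using pos by simp
  define w where "w = max x (z k)"
  define A where "A = c * exp (real k) * M k"
  have "A > 0" using \<open>0 < c\<close> pos[of k] by (simp add: A_def)
  have w: "x \<le> w" "z k \<le> w" "w \<le> y" using Suc.prems by (auto simp: w_def)
  have Fw: "\<bar>F k w\<bar> \<le> A * exp (L * (w - x))"
  proof (cases "z k \<le> x")
    case True
    then have "w = x" by (simp add: w_def)
    then show ?thesis using start[OF True] by (simp add: A_def)
  next
    case False
    then have "w = z k" by (simp add: w_def)
    then show ?thesis using zero[of k] \<open>A > 0\<close> by simp
  qed
  have step: "\<bar>F (Suc k) t\<bar> \<le> A * L * exp (L * (t - x))" if t: "w \<le> t" "t \<le> y" for t
  proof -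
    have "z (Suc k) \<le> t" using decseqD[OF dec, of k "Suc k"] w t by simp
    then have "\<bar>F (Suc k) t\<bar> \<le> c * exp (L * (t - x)) * exp (real (Suc k)) * M (Suc k)"
      using Suc.hyps t w Suc.prems unfolding L_def by (intro Suc.hyps(1)) auto
    \<comment> \<open>As \<open>k \<le> n\<close>, monotone ratios trade \<open>M (Suc k)\<close>
      for a multiple of \<open>M k\<close>; with the extra factor e from
      \<open>exp (real (Suc k))\<close> this gives the rate \<open>L\<close>.\<close>
    also have "M (Suc k) \<le> M (Suc n) / M n * M k"
      using ratio[of k n] Suc.hyps(2) pos[of k] by (simp add: pos_divide_le_eq)
    then have "c * exp (L * (t - x)) * exp (real (Suc k)) * M (Suc k)
       \<le> c * exp (L * (t - x)) * exp (real (Suc k)) * (M (Suc n) / M n * M k)"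
      using \<open>0 < c\<close> by (intro mult_left_mono) auto
    also have "\<dots> = A * L * exp (L * (t - x))"
      by (simp add: A_def L_def exp_add mult_ac)
    finally show ?thesis .
  qed
  \<comment> \<open>The majorant \<open>A * exp (L * (t - x))\<close> has as derivative the bound in
    \<open>step\<close>, so its difference with \<open>s * F k\<close> is nondecreasing; the two
    signs of \<open>s\<close> give the absolute value.\<close>
  have side: "s * F k y \<le> A * exp (L * (y - x))" if s: "\<bar>s\<bar> = 1" for s :: real
  proof -
    have "A * exp (L * (w - x)) - s * F k w \<le> A * exp (L * (y - x)) - s * F k y"
    proof (rule DERIV_nonneg_imp_nondecreasing[OF w(3)])
      fix t assume t: "w \<le> t" "t \<le> y"
      have "((\<lambda>t. A * exp (L * (t - x)) - s * F k t) has_real_derivative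
              A * L * exp (L * (t - x)) - s * F (Suc k) t) (at t)"
        using t w x Suc.prems by (auto intro!: derivative_eq_intros deriv)
      moreover have "s * F (Suc k) t \<le> \<bar>F (Suc k) t\<bar>"
        using s abs_ge_self[of "s * F (Suc k) t"] by (simp add: abs_mult)
      ultimately show "\<exists>v. ((\<lambda>t. A * exp (L * (t - x)) - s * F k t) has_real_derivative v) (at t) \<and> 0 \<le> v"
        using step[OF t] by (intro exI conjI) auto
    qed
    moreover have "s * F k w \<le> \<bar>F k w\<bar>"
      using s abs_ge_self[of "s * F k w"] by (simp add: abs_mult)
    ultimately show ?thesis using Fw by linarith
  qed
  have "\<bar>F k y\<bar> \<le> A * exp (L * (y - x))"
    using side[of 1] side[of "-1"] by auto
  then show ?case by (simp add: A_def L_def mult_ac)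
qed

text \<open>To the right of \<open>z T\<close>, the estimate with factor \<open>exp (- n)\<close>
  persists within the interval over the length \<open>S n T\<close>, a partial sum of the divergent
  series divided by e. For large \<open>T\<close> it reaches \<open>p\<close>, and letting
  \<open>n\<close> grow forces the value 0.\<close>

theorem bang_vanishing:
  fixes M :: "nat \<Rightarrow> real" and F :: "nat \<Rightarrow> real \<Rightarrow> real"
  assumes pos: "\<And>k. M k > 0"
    and ratio: "\<And>j k. j \<le> k \<Longrightarrow> M (Suc j) / M j \<le> M (Suc k) / M k"
    and qa: "\<not> summable (\<lambda>k. M k / M (Suc k))"
    and deriv: "\<And>k t. t \<in> {a..b} \<Longrightarrow> (F k has_real_derivative F (Suc k) t) (at t)"
    and bound: "\<And>k t. t \<in> {a..b} \<Longrightarrow> \<bar>F k t\<bar> \<le> M k"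
    and zero: "\<And>k. F k (z k) = 0" and z: "\<And>k. z k \<in> {a..b}" and dec: "decseq z"
    and p: "z 0 \<le> p" "p \<le> b"
  shows "F 0 p = 0"
proof -
  define S where "S n T = (\<Sum>k=n..<T. M k / M (Suc k) / exp 1)" for n T
  have S_nonneg: "0 \<le> S n T" for n T
    unfolding S_def using pos by (intro sum_nonneg) (simp add: less_imp_le)
  \<comment> \<open>Downward induction on \<open>n\<close> from \<open>T\<close>: each stage gains
    the length \<open>M n / M (Suc n) / exp 1\<close> and loses one factor e.\<close>
  have level: "\<bar>F k y\<bar> \<le> exp (- real n) * exp (real k) * M k"
    if "n \<le> T" "z T \<le> y" "y \<le> z T + S n T" "y \<le> b" "z k \<le> y" for n T y k
    using that
  proof (induction arbitrary: y k rule: inc_induct)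
    case base
    then have y: "y = z T" by (simp add: S_def)
    show ?case
    proof (cases "k < T")
      case True
      then have "z k = y" using y base decseqD[OF dec, of k T] by simp
      then show ?thesis using zero[of k] pos[of k] by simp
    next
      case False
      then have "1 \<le> exp (- real T) * exp (real k)" by (simp flip: exp_add)
      then have "1 * M k \<le> exp (- real T) * exp (real k) * M k"
        using pos[of k] by (intro mult_right_mono) auto
      moreover have "\<bar>F k y\<bar> \<le> M k" using y z by (intro bound) auto
      ultimately show ?thesis by simp
    qed
  next
    case (step n)
    \<comment> \<open>The bound for \<open>Suc n\<close> is known up to \<open>x\<close>; the rest
      of the way to \<open>y\<close> is so short that the growth exponent there is at most
      1.\<close>
    define x where "x = min y (z T + S (Suc n) T)"
    have x: "z T \<le> x" "x \<le> y" using step.prems S_nonneg by (auto simp: x_def)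
    have "S n T = M n / M (Suc n) / exp 1 + S (Suc n) T"
      unfolding S_def using step.hyps by (simp add: sum.atLeast_Suc_lessThan)
    then have "y - x \<le> M n / M (Suc n) / exp 1"
      using step.prems pos[of n] pos[of "Suc n"] by (auto simp: x_def min_def)
    then have "exp 1 * (M (Suc n) / M n) * (y - x)
        \<le> exp 1 * (M (Suc n) / M n) * (M n / M (Suc n) / exp 1)"
      using pos[of n] pos[of "Suc n"] by (intro mult_left_mono) auto
    also have "\<dots> = 1" using pos[of n] pos[of "Suc n"] by simp
    finally have growth: "exp 1 * (M (Suc n) / M n) * (y - x) \<le> 1" .
    have "\<bar>F k y\<bar> \<le> exp (- real (Suc n)) * exp (exp 1 * (M (Suc n) / M n) * (y - x)) * exp (real k) * M k"
    proof (rule bang_propagate[where a = a and b = b and z = z and F = F and M = M])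
      show "\<bar>F k x\<bar> \<le> exp (- real (Suc n)) * exp (real k) * M k" if "z k \<le> x" for k
        using that x step.prems by (intro step.IH) (auto simp: x_def)
      show "a \<le> x" using x z[of T] by auto
    qed (use pos ratio deriv bound zero z dec x step.prems in auto)
    also have "\<dots> \<le> exp (- real (Suc n)) * exp 1 * exp (real k) * M k"
      using growth pos[of k] by (intro mult_right_mono mult_left_mono) auto
    also have "exp (- real (Suc n)) * exp 1 = exp (- real n)"
      by (simp flip: exp_add)
    finally show ?case .
  qed
  have small: "\<bar>F 0 p\<bar> \<le> exp (- real n) * M 0" for n
  proof -
    \<comment> \<open>The length \<open>p - a\<close> bounds \<open>p - z T\<close> for every
      \<open>T\<close>; if no \<open>T\<close> sufficed, a tail of the series would have bounded
      partial sums.\<close>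
    have "\<exists>T\<ge>n. p - a \<le> S n T"
    proof (rule ccontr)
      assume "\<not> (\<exists>T\<ge>n. p - a \<le> S n T)"
      then have less: "S n T < p - a" if "T \<ge> n" for T using that by force
      have "summable (\<lambda>k. M (k + n) / M (Suc (k + n)))"
      proof (rule bounded_imp_summable)
        show "0 \<le> M (k + n) / M (Suc (k + n))" for k using pos by (simp add: less_imp_le)
        show "(\<Sum>k\<le>m. M (k + n) / M (Suc (k + n))) \<le> (p - a) * exp 1" for m
        proof -
          have "S n (Suc m + n) * exp 1 = (\<Sum>k=0 + n..<Suc m + n. M k / M (Suc k))"
            unfolding S_def by (simp only: sum_divide_distrib[symmetric] add_0) simp
          also have "\<dots> = (\<Sum>k\<le>m. M (k + n) / M (Suc (k + n)))"
            by (simp only: sum.shift_bounds_nat_ivl atLeast0LessThan lessThan_Suc_atMost)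
          finally have "(\<Sum>k\<le>m. M (k + n) / M (Suc (k + n))) = S n (Suc m + n) * exp 1" ..
          then show ?thesis using less[of "Suc m + n"] by simp
        qed
      qed
      then show False using qa summable_iff_shift[of "\<lambda>k. M k / M (Suc k)" n] by simp
    qed
    then obtain T where T: "n \<le> T" "p - a \<le> S n T" by blast
    have "z T \<le> z 0" using dec by (simp add: decseqD)
    then show ?thesis using level[of n T p 0] T p z[of T] by simp
  qed
  have "(\<lambda>n. exp (- real n) * M 0) \<longlonglongrightarrow> 0 * M 0"
    by (intro tendsto_mult tendsto_const filterlim_compose[OF exp_at_bot]
        filterlim_compose[OF filterlim_uminus_at_bot_at_top] filterlim_real_sequentially)
  then have "\<bar>F 0 p\<bar> \<le> 0 * M 0"
    using small by (intro LIMSEQ_le_const) auto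
  then show ?thesis by simp
qed

section \<open>Absolute monotonicity from a positive jet\<close>

text \<open>A negative value of \<open>F 0\<close> yields a zero before it. A zero of
  \<open>F k\<close> and \<open>F k 0 > 0\<close> force a negative value of \<open>F (Suc k)\<close>
  before that zero, hence an earlier zero of \<open>F (Suc k)\<close>. These zeros decrease, so
  Bang's theorem gives \<open>F 0 x = 0\<close>, a contradiction.\<close>

lemma quasianalytic_positive_jet_imp_nonneg:
  fixes M :: "nat \<Rightarrow> real" and F :: "nat \<Rightarrow> real \<Rightarrow> real"
  assumes pos: "\<And>k. M k > 0"
    and ratio: "\<And>j k. j \<le> k \<Longrightarrow> M (Suc j) / M j \<le> M (Suc k) / M k"
    and qa: "\<not> summable (\<lambda>k. M k / M (Suc k))"
    and deriv: "\<And>k t. t \<in> {0..b} \<Longrightarrow> (F k has_real_derivative F (Suc k) t) (at t)"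
    and bound: "\<And>k t. t \<in> {0..b} \<Longrightarrow> \<bar>F k t\<bar> \<le> M k"
    and jet: "\<And>k. F k 0 > 0"
    and x: "x \<in> {0..b}"
  shows "F 0 x \<ge> 0"
proof (rule ccontr)
  assume neg: "\<not> F 0 x \<ge> 0"
  have zero_between: "\<exists>w. 0 < w \<and> w < y \<and> F k w = 0" if y: "0 \<le> y" "y \<le> b" "F k y < 0" for k y
  proof -
    have "continuous_on {0..y} (F k)"
      using y by (intro DERIV_continuous_on[where D = "F (Suc k)"])
        (auto intro!: has_field_derivative_at_within deriv)
    then obtain w where "0 \<le> w" "w \<le> y" "F k w = 0"
      using IVT2'[of "F k" y 0 0] y jet[of k] by force
    then show ?thesis using y jet[of k]
      by (metis less_irrefl order_le_less)
  qed
  have "\<exists>z. \<forall>k. (0 < z k \<and> z k < x \<and> F k (z k) = 0) \<and> z (Suc k) \<le> z k"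
  proof (rule dependent_nat_choice)
    show "\<exists>w. 0 < w \<and> w < x \<and> F 0 w = 0" using zero_between[of x 0] neg x by auto
  next
    fix w k assume w: "0 < w \<and> w < x \<and> F k w = 0"
    then obtain \<xi> where \<xi>: "0 < \<xi>" "\<xi> < w" "F k w - F k 0 = (w - 0) * F (Suc k) \<xi>"
      using MVT2[of 0 w "F k" "F (Suc k)"] deriv x by force
    then have "w * F (Suc k) \<xi> < 0" using w jet[of k] by simp
    then have "F (Suc k) \<xi> < 0" using w by (simp add: mult_less_0_iff)
    then obtain v where "0 < v" "v < \<xi>" "F (Suc k) v = 0"
      using zero_between[of \<xi> "Suc k"] \<xi> w x by auto
    then show "\<exists>v. (0 < v \<and> v < x \<and> F (Suc k) v = 0) \<and> v \<le> w"
      using \<xi> w by (intro exI[of _ v]) auto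
  qed
  then obtain z where z: "\<And>k. 0 < z k" "\<And>k. z k < x" "\<And>k. F k (z k) = 0"
      "\<And>k. z (Suc k) \<le> z k" by blast
  have "F 0 x = 0"
  proof (rule bang_vanishing[where a = 0 and b = b and z = z and F = F and M = M])
    show "z k \<in> {0..b}" for k using z(1,2)[of k] x by simp
    show "decseq z" using z(4) by (rule decseq_SucI)
    show "z 0 \<le> x" using z(2)[of 0] by simp
  qed (use pos ratio qa deriv bound z x in auto)
  then show False using neg by simp
qed

text \<open>Each derivative again has a positive jet, so all are nonnegative on the interval. Then
  every term and the remainder in Taylor's formula at 0 are nonnegative, and one term cannot exceed
  the total.\<close>

lemma quasianalytic_positive_jet_bound:
  fixes M :: "nat \<Rightarrow> real" and F :: "nat \<Rightarrow> real \<Rightarrow> real"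
  assumes pos: "\<And>k. M k > 0"
    and ratio: "\<And>j k. j \<le> k \<Longrightarrow> M (Suc j) / M j \<le> M (Suc k) / M k"
    and qa: "\<not> summable (\<lambda>k. M k / M (Suc k))"
    and deriv: "\<And>k t. t \<in> {0..b} \<Longrightarrow> (F k has_real_derivative F (Suc k) t) (at t)"
    and bound: "\<And>k t. t \<in> {0..b} \<Longrightarrow> \<bar>F k t\<bar> \<le> M k"
    and jet: "\<And>k. F k 0 > 0"
    and b: "0 < b"
  shows "F k 0 / fact k * b ^ k \<le> F 0 b"
proof -
  have nonneg: "F j t \<ge> 0" if t: "t \<in> {0..b}" for j t
  proof -
    have "F (0 + j) t \<ge> 0"
    proof (rule quasianalytic_positive_jet_imp_nonneg[where M = "\<lambda>k. M (k + j)" and b = b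
          and F = "\<lambda>k. F (k + j)"])
      show "\<not> summable (\<lambda>k. M (k + j) / M (Suc k + j))"
        using qa summable_iff_shift[of "\<lambda>k. M k / M (Suc k)" j] by simp
      show "(F (k + j) has_real_derivative F (Suc k + j) s) (at s)" if "s \<in> {0..b}" for k s
        using deriv[OF that, of "k + j"] by simp
      show "M (Suc i + j) / M (i + j) \<le> M (Suc k + j) / M (k + j)" if "i \<le> k" for i k
        using ratio[of "i + j" "k + j"] that by simp
    qed (use pos bound jet t in auto)
    then show ?thesis by simp
  qed
  \<comment> \<open>Order \<open>Suc k\<close> puts the term of degree \<open>k\<close> into the
    polynomial and not into the remainder.\<close>
  obtain t where t: "0 < t" "t < b"
    "F 0 b = (\<Sum>m<Suc k. F m 0 / fact m * b ^ m) + F (Suc k) t / fact (Suc k) * b ^ Suc k"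
    using Maclaurin[of b "Suc k" F "F 0"] b deriv by auto
  have "F k 0 / fact k * b ^ k \<le> (\<Sum>m<Suc k. F m 0 / fact m * b ^ m)"
    using jet b by (intro member_le_sum) (auto simp: less_imp_le)
  moreover have "F (Suc k) t / fact (Suc k) * b ^ Suc k \<ge> 0"
    using nonneg[of t "Suc k"] t b by (intro mult_nonneg_nonneg divide_nonneg_nonneg) auto
  ultimately show ?thesis using t by linarith
qed

section \<open>Restriction to a coordinate axis\<close>

text \<open>\<open>Dalpha\<close> chooses some enumeration of the multiset; a multiset with one
  repeated element has only one.\<close>

lemma Dalpha_replicate_mset: "Dalpha (replicate_mset k i) f = diffs (replicate k i) f"
proof -
  have "(SOME xs. mset xs = replicate_mset k i) = replicate k i"
  proof (rule some_equality)
    fix xs assume "mset xs = replicate_mset k i"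
    then have "length xs = k" "set xs \<subseteq> {i}"
      by (metis size_mset size_replicate_mset)
         (metis \<open>mset xs = _\<close> set_mset_mset set_mset_replicate_mset_subset empty_subsetI order_refl)
    then show "xs = replicate k i" by (metis replicate_eqI singletonD subsetD)
  qed simp
  then show ?thesis by (simp add: Dalpha_def)
qed

text \<open>Translation by \<open>t\<close> turns the derivative at 0 in \<open>pdiff\<close> into
  one at \<open>t\<close> along the axis. This provides the sequence \<open>F\<close> for the
  one-variable results.\<close>

lemma smooth_on_axis_deriv:
  fixes f :: "real^'n::finite \<Rightarrow> real"
  assumes "smooth_on U f" and "t *\<^sub>R axis i 1 \<in> U"
  shows "((\<lambda>t. diffs (replicate k i) f (t *\<^sub>R axis i 1)) has_real_derivative
            diffs (replicate (Suc k) i) f (t *\<^sub>R axis i 1)) (at t)"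
proof -
  let ?g = "\<lambda>s. diffs (replicate k i) f (t *\<^sub>R axis i 1 + s *\<^sub>R axis i 1)"
  have "?g differentiable (at 0)" using assms unfolding smooth_on_def by blast
  then have "(?g has_real_derivative deriv ?g 0) (at 0)"
    using DERIV_deriv_iff_real_differentiable by blast
  then have "((\<lambda>s. diffs (replicate k i) f ((t + s) *\<^sub>R axis i 1)) has_real_derivative
       diffs (replicate (Suc k) i) f (t *\<^sub>R axis i 1)) (at 0)"
    by (simp add: pdiff_def scaleR_add_left)
  then show ?thesis
    by (simp add: DERIV_shift[of _ _ 0 t, simplified] add.commute)
qed

lemma weight_seq_ratio_mono:
  assumes "weight_seq M" "j \<le> k"
  shows "M (Suc j) / M j \<le> M (Suc k) / M k"
proof -
  have "M (Suc p) / M p \<le> M (Suc (Suc p)) / M (Suc p)" for p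
  proof -
    have "(M (Suc p))\<^sup>2 \<le> M p * M (Suc (Suc p))" "M p > 0" "M (Suc p) > 0"
      using assms(1) unfolding weight_seq_def by (auto dest: spec[of _ "Suc p"])
    then show ?thesis by (simp add: field_simps power2_eq_square)
  qed
  then show ?thesis
    using lift_Suc_mono_le[of "\<lambda>p. M (Suc p) / M p" j k] assms(2) by blast
qed

text \<open>On an axis, a representing function has the derivatives \<open>fact k * c k > 0\<close>
  at 0, so the one-variable bound limits \<open>c\<close> to geometric growth.\<close>

lemma jet_germs_Roumieu_positive_radial:
  fixes c :: "nat \<Rightarrow> real"
  assumes M: "weight_seq M" and qa: "quasianalytic M"
    and c: "\<And>k. c k > 0"
    and germ: "(\<lambda>\<alpha>. c (size \<alpha>)) \<in> (jet_germs_Roumieu M :: ('n::finite multiset \<Rightarrow> real) set)"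
  shows "\<exists>R. \<forall>k>0. root k (c k) \<le> R"
proof -
  obtain f :: "real^'n \<Rightarrow> real" and q where q: "q \<ge> 1" and f: "f \<in> E_Roumieu M (cube q)"
    and jet: "jet f = (\<lambda>\<alpha>. c (size \<alpha>))"
    using germ unfolding jet_germs_Roumieu_def by auto
  \<comment> \<open>Any axis serves, since the jet depends only on the size of the
    multi-index.\<close>
  define i :: 'n where "i = undefined"
  define b where "b = 1 / (2 * real q)"
  have b: "0 < b" "b < 1 / real q" using q by (auto simp: b_def field_simps)
  define K where "K = (\<lambda>t. t *\<^sub>R axis i 1 :: real^'n) ` {0..b}"
  have "compact K" unfolding K_def by (intro compact_continuous_image continuous_intros) auto
  moreover have K: "K \<subseteq> cube q"
    using b q by (auto simp: K_def cube_def axis_def)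
  ultimately obtain h where h: "h > 0" "bounded_MKh M K h f" and smooth: "smooth_on (cube q) f"
    using f unfolding E_Roumieu_def by auto
  obtain C0 where C0: "\<And>\<alpha> x. x \<in> K \<Longrightarrow> \<bar>Dalpha \<alpha> f x\<bar> / (h ^ size \<alpha> * M (size \<alpha>)) \<le> C0"
    using h(2) unfolding bounded_MKh_def by blast
  define C where "C = max C0 1"
  have C: "C > 0" by (simp add: C_def)
  have Mpos: "M k > 0" for k using M by (simp add: weight_seq_def)
  define F where "F k t = diffs (replicate k i) f (t *\<^sub>R axis i 1)" for k t
  \<comment> \<open>\<open>P\<close> absorbs the constants of the class norm; \<open>h\<close>
    scales all quotients equally, so monotonicity and divergence carry over from
    \<open>M\<close>.\<close>
  define P where "P k = C * h ^ k * M k" for k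
  have est: "F k 0 / fact k * b ^ k \<le> F 0 b" for k
  proof (rule quasianalytic_positive_jet_bound[where M = P])
    show "P k > 0" for k using C h Mpos by (simp add: P_def)
    have Psuc: "P (Suc k) / P k = h * (M (Suc k) / M k)" for k
      using C h by (simp add: P_def)
    show "P (Suc j) / P j \<le> P (Suc k) / P k" if "j \<le> k" for j k
      unfolding Psuc using weight_seq_ratio_mono[OF M that] h by (intro mult_left_mono) auto
    have "P k / P (Suc k) = inverse h * (M k / M (Suc k))" for k
      using C h by (simp add: P_def field_simps)
    then have "summable (\<lambda>k. P k / P (Suc k)) \<longleftrightarrow> summable (\<lambda>k. M k / M (Suc k))"
      using h by (simp only: summable_cmult_iff) simp
    then show "\<not> summable (\<lambda>k. P k / P (Suc k))"
      using qa by (simp add: quasianalytic_def)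
    show "(F k has_real_derivative F (Suc k) t) (at t)" if "t \<in> {0..b}" for k t
      unfolding F_def using that K by (intro smooth_on_axis_deriv[OF smooth]) (auto simp: K_def)
    show "\<bar>F k t\<bar> \<le> P k" if "t \<in> {0..b}" for k t
    proof -
      have "\<bar>F k t\<bar> / (h ^ k * M k) \<le> C0"
        using C0[of "t *\<^sub>R axis i 1" "replicate_mset k i"] that
        by (simp add: K_def Dalpha_replicate_mset F_def)
      then have "\<bar>F k t\<bar> / (h ^ k * M k) \<le> C" by (simp add: C_def)
      then show ?thesis using h Mpos[of k] by (simp add: P_def pos_divide_le_eq mult_ac)
    qed
    show "F k 0 > 0" for k
      using fun_cong[OF jet, of "replicate_mset k i"] c[of k]
      by (simp add: jet_def Dalpha_replicate_mset F_def zero_less_divide_iff)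
        (metis fact_gt_zero zero_less_divide_iff not_less_iff_gr_or_eq)
    show "0 < b" by (rule b)
  qed
  \<comment> \<open>With \<open>B \<ge> 1\<close>, also \<open>B \<le> B ^ k\<close> for
    \<open>k > 0\<close>, so k-th roots give the uniform bound \<open>B / b\<close>.\<close>
  define B where "B = max 1 (F 0 b)"
  have "root k (c k) \<le> B / b" if k: "k > 0" for k
  proof -
    have "c k = F k 0 / fact k"
      using fun_cong[OF jet, of "replicate_mset k i"]
      by (simp add: jet_def Dalpha_replicate_mset F_def)
    then have "c k * b ^ k \<le> B" using est[of k] by (simp add: B_def)
    also have "B ^ 1 \<le> B ^ k" using k by (intro power_increasing) (auto simp: B_def)
    then have "B \<le> B ^ k" by simp
    finally have "c k \<le> (B / b) ^ k" using b by (simp add: power_divide pos_le_divide_eq)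
    then have "root k (c k) \<le> root k ((B / b) ^ k)" using k by simp
    also have "\<dots> = B / b" using k b by (intro real_root_power_cancel) (auto simp: B_def)
    finally show ?thesis .
  qed
  then show ?thesis by blast
qed

section \<open>Inclusion of the classes and radial test sequences\<close>

lemma jet_germs_Beurling_subset_Roumieu:
  "jet_germs_Beurling M \<subseteq> (jet_germs_Roumieu M :: ('n::finite multiset \<Rightarrow> real) set)"
proof -
  have "E_Beurling M U \<subseteq> (E_Roumieu M U :: (real^'n \<Rightarrow> real) set)" for U
    unfolding E_Beurling_def E_Roumieu_def by (auto intro: exI[of _ 1])
  then show ?thesis unfolding jet_germs_Beurling_def jet_germs_Roumieu_def by blast
qed

lemma radial_in_Lambda_Roumieu:
  assumes "weight_seq N"
  shows "(\<lambda>\<alpha>. N (size \<alpha>) / fact (size \<alpha>)) \<in> (Lambda_Roumieu N :: ('n::finite multiset \<Rightarrow> real) set)"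
proof -
  have "N k > 0" for k using assms by (simp add: weight_seq_def)
  then have "seq_bounded N 1 (\<lambda>\<alpha>::'n multiset. N (size \<alpha>) / fact (size \<alpha>))"
    unfolding seq_bounded_def by (intro exI[of _ 1]) (simp add: less_imp_le)
  then show ?thesis unfolding Lambda_Roumieu_def using zero_less_one by blast
qed

text \<open>The quotient to be bounded is \<open>1 / (h ^ k * sqrt (N k / fact k))\<close>, which is
  at most 1 once the k-th root of \<open>N k / fact k\<close> is at least
  \<open>(1 / h)\<^sup>2\<close>, that is, for all large \<open>k\<close>.\<close>

lemma radial_sqrt_in_Lambda_Beurling:
  assumes N: "weight_seq N"
    and lim: "filterlim (\<lambda>k. root k (N k / fact k)) at_top sequentially"
  shows "(\<lambda>\<alpha>. sqrt (N (size \<alpha>) / fact (size \<alpha>)))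
           \<in> (Lambda_Beurling N :: ('n::finite multiset \<Rightarrow> real) set)"
proof -
  have "seq_bounded N h (\<lambda>\<alpha>::'n multiset. sqrt (N (size \<alpha>) / fact (size \<alpha>)))"
    if h: "h > 0" for h
  proof -
    define g where "g k = sqrt (N k / fact k) / (h ^ k * (N k / fact k))" for k
    have "eventually (\<lambda>k. root k (N k / fact k) \<ge> (1 / h)\<^sup>2) sequentially"
      using lim by (simp add: filterlim_at_top)
    then obtain k0 where k0: "\<And>k. k \<ge> k0 \<Longrightarrow> root k (N k / fact k) \<ge> (1 / h)\<^sup>2"
      by (auto simp: eventually_sequentially)
    have tail: "g k \<le> 1" if k: "k \<ge> Suc k0" for k
    proof -
      have n: "N k / fact k > 0" using N by (simp add: weight_seq_def)
      have "((1 / h)\<^sup>2) ^ k \<le> root k (N k / fact k) ^ k"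
        using k0[of k] k h by (intro power_mono) auto
      also have "\<dots> = N k / fact k" using k n by (intro real_root_pow_pos2) auto
      finally have "((1 / h) ^ k)\<^sup>2 \<le> N k / fact k" by (simp flip: power_mult add: mult.commute)
      then have "(1 / h) ^ k \<le> sqrt (N k / fact k)" by (rule real_le_rsqrt)
      then have "1 \<le> h ^ k * sqrt (N k / fact k)"
        using h by (simp add: power_divide pos_divide_le_eq mult.commute)
      then have "sqrt (N k / fact k) * 1 \<le> sqrt (N k / fact k) * (h ^ k * sqrt (N k / fact k))"
        using n by (intro mult_left_mono) auto
      also have "\<dots> = h ^ k * (sqrt (N k / fact k))\<^sup>2"
        by (simp only: power2_eq_square mult_ac)
      also have "(sqrt (N k / fact k))\<^sup>2 = N k / fact k" using n by (intro real_sqrt_pow2) simp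
      finally show ?thesis
        unfolding g_def using h n by (subst pos_divide_le_eq) (simp_all only: mult_1 mult_1_right mult_pos_pos zero_less_power)
    qed
    define C where "C = Max (insert 1 (g ` {..k0}))"
    have "g k \<le> C" for k
    proof (cases "k \<le> k0")
      case True
      then show ?thesis unfolding C_def by (intro Max_ge) auto
    next
      case False
      then have "g k \<le> 1" by (intro tail) simp
      also have "1 \<le> C" by (simp add: C_def)
      finally show ?thesis .
    qed
    moreover have "N k > 0" for k using N by (simp add: weight_seq_def)
    ultimately show ?thesis unfolding seq_bounded_def g_def
      by (intro exI[of _ C]) (simp add: less_imp_le)
  qed
  then show ?thesis unfolding Lambda_Beurling_def by blast
qed

section \<open>Strict inclusions and failure of surjectivity\<close>

theorem mainTheorem3:
  fixes M N :: "nat \<Rightarrow> real"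
  assumes "weight_seq M" and "weight_seq N"
    and "quasianalytic M" and "quasianalytic N"
  shows
   "((\<forall>C. \<exists>k>0. root k (N k / fact k) > C) \<longrightarrow>
       jet_germs_Roumieu M \<inter> Lambda_Roumieu N \<subset> (Lambda_Roumieu N :: ('n::finite multiset \<Rightarrow> real) set) \<and>
       jet_germs_Beurling M \<inter> Lambda_Roumieu N \<subset> (Lambda_Roumieu N :: ('n multiset \<Rightarrow> real) set) \<and>
       \<not> (Lambda_Roumieu N \<subseteq> (jet_germs_Roumieu N :: ('n multiset \<Rightarrow> real) set))) \<and>
    (filterlim (\<lambda>k. root k (N k / fact k)) at_top sequentially \<longrightarrow>
       jet_germs_Roumieu M \<inter> Lambda_Beurling N \<subset> (Lambda_Beurling N :: ('n multiset \<Rightarrow> real) set) \<and>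
       jet_germs_Beurling M \<inter> Lambda_Beurling N \<subset> (Lambda_Beurling N :: ('n multiset \<Rightarrow> real) set) \<and>
       \<not> (Lambda_Beurling N \<subseteq> (jet_germs_Beurling N :: ('n multiset \<Rightarrow> real) set)))"
proof -
  have pos: "N k / fact k > 0" for k using assms(2) by (simp add: weight_seq_def)
  show ?thesis
  proof (intro conjI[of "_ \<longrightarrow> _"] impI)
    assume sup: "\<forall>C. \<exists>k>0. root k (N k / fact k) > C"
    let ?u = "\<lambda>\<alpha>::'n multiset. N (size \<alpha>) / fact (size \<alpha>)"
    \<comment> \<open>\<open>W\<close> is \<open>M\<close> for the strict inclusions and
      \<open>N\<close> for the failure of surjectivity.\<close>
    have "?u \<notin> jet_germs_Roumieu W" if "weight_seq W" "quasianalytic W" for W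
    proof
      assume "?u \<in> jet_germs_Roumieu W"
      then have "\<exists>R. \<forall>k>0. root k (N k / fact k) \<le> R"
        using jet_germs_Roumieu_positive_radial[OF that, of "\<lambda>k. N k / fact k"] pos by blast
      then show False using sup by (meson not_le)
    qed
    then have "?u \<notin> jet_germs_Roumieu M" "?u \<notin> jet_germs_Roumieu N"
      using assms by auto
    then show "jet_germs_Roumieu M \<inter> Lambda_Roumieu N \<subset> (Lambda_Roumieu N :: ('n multiset \<Rightarrow> real) set) \<and>
       jet_germs_Beurling M \<inter> Lambda_Roumieu N \<subset> (Lambda_Roumieu N :: ('n multiset \<Rightarrow> real) set) \<and>
       \<not> (Lambda_Roumieu N \<subseteq> (jet_germs_Roumieu N :: ('n multiset \<Rightarrow> real) set))"
      using radial_in_Lambda_Roumieu[OF assms(2)] jet_germs_Beurling_subset_Roumieu[of M] by blast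
  next
    assume lim: "filterlim (\<lambda>k. root k (N k / fact k)) at_top sequentially"
    \<comment> \<open>\<open>N k / fact k\<close> itself violates the Beurling condition for
      \<open>h < 1\<close>. Its square root satisfies it, and the k-th roots remain unbounded, being
      square roots of the old ones.\<close>
    let ?u = "\<lambda>\<alpha>::'n multiset. sqrt (N (size \<alpha>) / fact (size \<alpha>))"
    have "?u \<notin> jet_germs_Roumieu W" if W: "weight_seq W" "quasianalytic W" for W
    proof
      assume "?u \<in> jet_germs_Roumieu W"
      then obtain R where R: "\<And>k. k > 0 \<Longrightarrow> root k (sqrt (N k / fact k)) \<le> R"
        using jet_germs_Roumieu_positive_radial[OF W, of "\<lambda>k. sqrt (N k / fact k)"] pos
        by (metis real_sqrt_gt_zero)
      have "eventually (\<lambda>k. root k (N k / fact k) > R\<^sup>2) sequentially"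
        using lim by (simp add: filterlim_at_top_dense)
      then obtain k where k: "k > 0" "root k (N k / fact k) > R\<^sup>2"
        using eventually_happens'[OF sequentially_bot eventually_conj[OF eventually_gt_at_top[of 0]]]
        by blast
      have "R < sqrt (root k (N k / fact k))" using k(2) by (rule real_less_rsqrt)
      also have "\<dots> = root k (sqrt (N k / fact k))"
        by (simp only: sqrt_def real_root_commute)
      finally show False using R[OF k(1)] by simp
    qed
    then have "?u \<notin> jet_germs_Roumieu M" "?u \<notin> jet_germs_Roumieu N"
      using assms by auto
    then show "jet_germs_Roumieu M \<inter> Lambda_Beurling N \<subset> (Lambda_Beurling N :: ('n multiset \<Rightarrow> real) set) \<and>
       jet_germs_Beurling M \<inter> Lambda_Beurling N \<subset> (Lambda_Beurling N :: ('n multiset \<Rightarrow> real) set) \<and>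
       \<not> (Lambda_Beurling N \<subseteq> (jet_germs_Beurling N :: ('n multiset \<Rightarrow> real) set))"
      using radial_sqrt_in_Lambda_Beurling[OF assms(2) lim] jet_germs_Beurling_subset_Roumieu[of M]
        jet_germs_Beurling_subset_Roumieu[of N] by blast
  qed
qed

end
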